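(* Let $n\ge 1$ and let $T:S_n(\mathbb{R})\to S_n(\mathbb{R})$ be a linear transformation of rank $1$. Then $T$ is positive definite preserving if and only if there exist a positive definite matrix $U\in S_n(\mathbb{R})$ and a non-zero positive semi-definite matrix $B\in S_n(\mathbb{R})$ such that $T(A)=\operatorname{tr}(AB)\,U$ for every $A\in S_n(\mathbb{R})$.
   Context: $S_n(\mathbb{R})$ is the real vector space of real symmetric $n\times n$ matrices. The rank of a linear transformation $T:S_n(\mathbb{R})\to S_n(\mathbb{R})$ is the dimension of its image. $T$ is called positive definite preserving if $T(A)$ is positive definite whenever $A\in S_n(\mathbb{R})$ is positive definite. *)

theory Defs
  imports "HOL-Analysis.Analysis"
begin

definition sym_matrices :: "(real^'n^'n) set"
  where "sym_matrices = {A. transpose A = A}"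

lemma subspace_sym_matrices: "subspace (sym_matrices :: (real^'n^'n) set)"
  by (auto simp: subspace_def sym_matrices_def transpose_def vec_eq_iff)

definition pos_def :: "real^'n^'n \<Rightarrow> bool"
  where "pos_def A \<longleftrightarrow> A \<in> sym_matrices \<and> (\<forall>x. x \<noteq> 0 \<longrightarrow> x \<bullet> (A *v x) > 0)"

definition pos_semidef :: "real^'n^'n \<Rightarrow> bool"
  where "pos_semidef A \<longleftrightarrow> A \<in> sym_matrices \<and> (\<forall>x. x \<bullet> (A *v x) \<ge> 0)"

(* A map between symmetric matrices is a function on all matrices of which only the restriction
   to sym_matrices matters; its values elsewhere are unconstrained. *)
definition linear_sym :: "(real^'n^'n \<Rightarrow> real^'n^'n) \<Rightarrow> bool"
  where "linear_sym T \<longleftrightarrow>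
    T ` sym_matrices \<subseteq> sym_matrices \<and>
    (\<forall>A\<in>sym_matrices. \<forall>B\<in>sym_matrices. T (A + B) = T A + T B) \<and>
    (\<forall>c. \<forall>A\<in>sym_matrices. T (c *\<^sub>R A) = c *\<^sub>R T A)"

definition rank_sym :: "(real^'n^'n \<Rightarrow> real^'n^'n) \<Rightarrow> nat"
  where "rank_sym T = dim (T ` sym_matrices)"

definition pos_def_preserving :: "(real^'n^'n \<Rightarrow> real^'n^'n) \<Rightarrow> bool"
  where "pos_def_preserving T \<longleftrightarrow> (\<forall>A\<in>sym_matrices. pos_def A \<longrightarrow> pos_def (T A))"

end

theory Submission
  imports Defs
begin

text \<open>A linear map of rank \<open>1\<close> that sends the identity to a positive definite \<open>U\<close> has the form
  \<open>A \<mapsto> f A U\<close> for a linear functional \<open>f\<close>, and \<open>f\<close> is represented by a symmetric \<open>B\<close> in the trace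
  inner product. Perturbing \<open>v v\<^sup>T\<close> by small multiples of the identity gives
  \<open>v \<bullet> B v = f (v v\<^sup>T) \<ge> 0\<close>. Conversely, clearing one row of a positive semidefinite \<open>B\<close> at a time
  by subtracting \<open>v v\<^sup>T / B\<^sub>k\<^sub>k\<close>, with \<open>v\<close> the \<open>k\<close>-th column, writes \<open>B\<close> as a nonnegative
  combination of matrices \<open>v v\<^sup>T\<close>, on which \<open>tr (A \<cdot>)\<close> takes the values \<open>v \<bullet> A v\<close>.\<close>

section \<open>Rank-one matrices and the trace inner product\<close>

definition outer :: "real^'n \<Rightarrow> real^'n^'n"
  where "outer v = (\<chi> i j. v $ i * v $ j)"

lemma sym_matrices_nth: "A \<in> sym_matrices \<Longrightarrow> A $ i $ j = A $ j $ i"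
  unfolding sym_matrices_def transpose_def vec_eq_iff by simp

lemma sym_matricesI: "(\<And>i j. A $ i $ j = A $ j $ i) \<Longrightarrow> A \<in> sym_matrices"
  unfolding sym_matrices_def transpose_def vec_eq_iff by simp

lemma outer_sym: "outer v \<in> sym_matrices"
  by (rule sym_matricesI) (simp add: outer_def)

lemma mat_1_sym: "mat 1 \<in> sym_matrices"
  by (simp add: sym_matrices_def)

lemma outer_mult_vec: "outer v *v x = (v \<bullet> x) *\<^sub>R v"
  by (simp add: vec_eq_iff outer_def matrix_vector_mult_def inner_vec_def
      sum_distrib_left mult_ac)

lemma inner_outer: "A \<bullet> outer v = v \<bullet> (A *v v)"
  by (simp add: outer_def matrix_vector_mult_def inner_vec_def sum_distrib_left mult_ac)

lemma inner_transpose: "(A :: real^'n^'n) \<bullet> transpose B = transpose A \<bullet> B"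
  unfolding inner_vec_def transpose_def
  by simp (rule sum.swap)

text \<open>Symmetry of \<open>B\<close> swaps the indices in the diagonal sums of the product, so
  the trace form becomes the entrywise inner product used below.\<close>

lemma trace_mult_sym:
  assumes "B \<in> sym_matrices"
  shows "trace (A ** B) = A \<bullet> B"
  unfolding trace_def matrix_matrix_mult_def inner_vec_def
  by (simp add: sym_matrices_nth[OF assms])

section \<open>Positive semidefinite matrices and the clearing of rows\<close>

lemma sym_inner_commute:
  assumes "A \<in> sym_matrices"
  shows "x \<bullet> (A *v y) = y \<bullet> (A *v x)"
  using assms dot_lmul_matrix[of x A y]
  by (simp add: sym_matrices_def inner_commute flip: transpose_matrix_vector)

text \<open>The form of \<open>A\<close> is nonnegative on every combination of \<open>x\<close> and
  \<open>y\<close>; suitable coefficients yield the bound, even for a degenerate form.\<close>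

lemma pos_semidef_cauchy_schwarz:
  assumes "pos_semidef A"
  shows "(x \<bullet> (A *v y))\<^sup>2 \<le> (x \<bullet> (A *v x)) * (y \<bullet> (A *v y))"
proof -
  define a b c where "a = x \<bullet> (A *v x)" and "b = x \<bullet> (A *v y)" and "c = y \<bullet> (A *v y)"
  have sym: "y \<bullet> (A *v x) = b"
    using assms sym_inner_commute unfolding b_def pos_semidef_def by blast
  have quad: "0 \<le> s\<^sup>2 * a + 2 * s * t * b + t\<^sup>2 * c" for s t
  proof -
    have "0 \<le> (s *\<^sub>R x + t *\<^sub>R y) \<bullet> (A *v (s *\<^sub>R x + t *\<^sub>R y))"
      using assms by (simp add: pos_semidef_def)
    also have "\<dots> = s\<^sup>2 * a + 2 * s * t * b + t\<^sup>2 * c"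
      by (simp add: sym a_def c_def algebra_simps power2_eq_square flip: b_def)
    finally show ?thesis .
  qed
  have "0 \<le> a" "0 \<le> c" using assms by (simp_all add: a_def c_def pos_semidef_def)
  have "b\<^sup>2 \<le> a * c"
  proof (cases "a = 0")
    case True
    \<comment> \<open>With \<open>a = 0\<close> the form is
      \<open>2 * s * t * b + t\<^sup>2 * c\<close>; these coefficients make the mixed term outweigh
      the last one, which forces \<open>b = 0\<close>.\<close>
    have "0 \<le> - (b\<^sup>2 * (c + 2))"
      using quad[of "- (c + 1)" b] True by (simp add: algebra_simps power2_eq_square)
    then have "b\<^sup>2 * (c + 2) \<le> 0" by simp
    then have "b\<^sup>2 \<le> 0" using \<open>0 \<le> c\<close> by (simp add: mult_le_0_iff)
    then show ?thesis using True by simp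
  next
    case False
    have "0 \<le> a * (a * c - b\<^sup>2)"
      using quad[of "- b" a] by (simp add: algebra_simps power2_eq_square)
    then show ?thesis using False \<open>0 \<le> a\<close> by (simp add: zero_le_mult_iff)
  qed
  then show ?thesis by (simp add: a_def b_def c_def)
qed

lemma axis_inner_mult_vec: "axis k 1 \<bullet> (A *v axis j (1::real)) = A $ k $ j"
  by (simp add: matrix_vector_mult_basis inner_axis' column_def)

lemma pos_semidef_diag_nonneg: "pos_semidef A \<Longrightarrow> 0 \<le> A $ k $ k"
  using axis_inner_mult_vec[of k A k] unfolding pos_semidef_def by metis

text \<open>By Cauchy-Schwarz on unit vectors, a zero diagonal entry would annihilate its whole row.
  This supplies the pivot for clearing a row.\<close>

lemma pos_semidef_diag_pos:
  assumes "pos_semidef A" "A $ k \<noteq> 0"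
  shows "0 < A $ k $ k"
proof -
  obtain j where j: "A $ k $ j \<noteq> 0" using assms(2) by (auto simp: vec_eq_iff)
  have "(A $ k $ j)\<^sup>2 \<le> A $ k $ k * A $ j $ j"
    using pos_semidef_cauchy_schwarz[OF assms(1), of "axis k 1" "axis j 1"]
    by (simp add: axis_inner_mult_vec)
  with j have "A $ k $ k \<noteq> 0" by auto
  then show ?thesis using pos_semidef_diag_nonneg[OF assms(1), of k] by simp
qed

text \<open>The subtracted term contributes a square divided by the pivot, which Cauchy-Schwarz for
  \<open>x\<close> and the \<open>k\<close>-th unit vector bounds by the form of \<open>A\<close> at
  \<open>x\<close>.\<close>

lemma pos_semidef_clear_row:
  assumes "pos_semidef A" "0 < A $ k $ k"
  shows "pos_semidef (A - (1 / A $ k $ k) *\<^sub>R outer (column k A))" (is "pos_semidef ?A'")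
  unfolding pos_semidef_def
proof (intro conjI allI)
  have sym: "A \<in> sym_matrices" using assms by (simp add: pos_semidef_def)
  show "?A' \<in> sym_matrices"
    by (intro subspace_diff subspace_scale subspace_sym_matrices outer_sym sym)
  fix x
  have col: "column k A \<bullet> x = axis k 1 \<bullet> (A *v x)"
    using sym_inner_commute[OF sym, of "axis k 1" x]
    by (simp add: matrix_vector_mult_basis inner_commute)
  have "(axis k 1 \<bullet> (A *v x))\<^sup>2 \<le> A $ k $ k * (x \<bullet> (A *v x))"
    using pos_semidef_cauchy_schwarz[OF assms(1), of "axis k 1" x]
    by (simp add: axis_inner_mult_vec)
  then have "(axis k 1 \<bullet> (A *v x))\<^sup>2 / A $ k $ k \<le> x \<bullet> (A *v x)"
    using assms(2) by (simp add: pos_divide_le_eq mult.commute)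
  moreover have "x \<bullet> (?A' *v x) = x \<bullet> (A *v x) - (axis k 1 \<bullet> (A *v x))\<^sup>2 / A $ k $ k"
    by (simp add: matrix_vector_mult_diff_rdistrib scaleR_matrix_vector_assoc[symmetric]
        outer_mult_vec inner_diff_right inner_commute[of x "column k A"] col power2_eq_square)
  ultimately show "0 \<le> x \<bullet> (?A' *v x)" by simp
qed

lemma inner_clear_row:
  "A \<bullet> B = A \<bullet> (B - c *\<^sub>R outer v) + c * (v \<bullet> (A *v v))"
  by (simp add: inner_diff_right inner_outer)

text \<open>Induction on the number of nonzero rows of \<open>B\<close>: clearing row
  \<open>k\<close> keeps zero rows zero and removes one more.\<close>

lemma pos_semidef_inner_nonneg:
  assumes "pos_semidef A" "pos_semidef B"
  shows "0 \<le> A \<bullet> B"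
  using assms(2)
proof (induction "card {k. B $ k \<noteq> 0}" arbitrary: B rule: less_induct)
  case less
  show ?case
  proof (cases "B = 0")
    case False
    then obtain k where k: "B $ k \<noteq> 0" by (metis vec_eq_iff zero_index)
    have pos: "0 < B $ k $ k" using pos_semidef_diag_pos[OF less.prems k] .
    define B' where "B' = B - (1 / B $ k $ k) *\<^sub>R outer (column k B)"
    have B'_nth: "B' $ i $ j = B $ i $ j - B $ i $ k * B $ j $ k / B $ k $ k" for i j
      by (simp add: B'_def outer_def column_def)
    have "B' $ i = 0" if "B $ i = 0" for i
      using that by (simp add: vec_eq_iff[of "B' $ i"] B'_nth)
    moreover have "B' $ k = 0"
    proof -
      have "B' $ k $ j = 0" for j
        using less.prems pos sym_matrices_nth[of B j k] by (simp add: pos_semidef_def B'_nth)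
      then show ?thesis by (simp add: vec_eq_iff)
    qed
    ultimately have "{i. B' $ i \<noteq> 0} \<subset> {i. B $ i \<noteq> 0}" using k by blast
    then have "card {i. B' $ i \<noteq> 0} < card {i. B $ i \<noteq> 0}"
      by (simp add: psubset_card_mono)
    then have "0 \<le> A \<bullet> B'"
      using less.hyps pos_semidef_clear_row[OF less.prems pos] by (simp add: B'_def)
    moreover have "0 \<le> column k B \<bullet> (A *v column k B)"
      using assms(1) by (simp add: pos_semidef_def)
    ultimately show ?thesis
      using pos inner_clear_row[of A B "1 / B $ k $ k" "column k B"] by (simp add: B'_def)
  qed simp
qed

section \<open>Positive definite matrices\<close>

lemma pos_def_imp_pos_semidef: "pos_def A \<Longrightarrow> pos_semidef A"
  unfolding pos_def_def pos_semidef_def by (metis inner_zero_left order.refl less_imp_le)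

text \<open>One clearing step suffices: the remainder contributes a nonnegative amount, and the
  split-off rank-one term a positive one because its column contains the pivot.\<close>

lemma pos_def_inner_pos:
  assumes "pos_def A" "pos_semidef B" "B \<noteq> 0"
  shows "0 < A \<bullet> B"
proof -
  obtain k where k: "B $ k \<noteq> 0" using assms(3) by (metis vec_eq_iff zero_index)
  have pos: "0 < B $ k $ k" using pos_semidef_diag_pos[OF assms(2) k] .
  then have "column k B $ k \<noteq> 0" by (simp add: column_def)
  then have "column k B \<noteq> 0" by auto
  then have "0 < column k B \<bullet> (A *v column k B)" using assms(1) by (simp add: pos_def_def)
  moreover have "0 \<le> A \<bullet> (B - (1 / B $ k $ k) *\<^sub>R outer (column k B))"
    using pos_semidef_inner_nonneg[OF pos_def_imp_pos_semidef[OF assms(1)]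
        pos_semidef_clear_row[OF assms(2) pos]] .
  ultimately show ?thesis
    using pos inner_clear_row[of A B "1 / B $ k $ k" "column k B"] by (simp add: add_nonneg_pos)
qed

lemma pos_def_scaleR: "pos_def U \<Longrightarrow> 0 < c \<Longrightarrow> pos_def (c *\<^sub>R U)"
  by (simp add: pos_def_def subspace_scale[OF subspace_sym_matrices]
      scaleR_matrix_vector_assoc[symmetric])

lemma pos_def_mat_1: "pos_def (mat 1)"
  by (simp add: pos_def_def mat_1_sym)

lemma pos_def_nonzero: "pos_def U \<Longrightarrow> U \<noteq> 0"
proof
  assume "pos_def U" "U = 0"
  then have "(0::real) < axis k 1 \<bullet> (0 *v axis k (1::real))" for k :: 'a
    unfolding pos_def_def by (metis axis_eq_0_iff zero_neq_one)
  then show False by simp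
qed

lemma pos_def_outer_add:
  fixes v :: "real^'n"
  assumes "0 < e"
  shows "pos_def (outer v + e *\<^sub>R mat 1)"
  unfolding pos_def_def
proof (intro conjI allI impI)
  show "outer v + e *\<^sub>R mat 1 \<in> sym_matrices"
    by (intro subspace_add subspace_scale subspace_sym_matrices outer_sym mat_1_sym)
  fix x :: "real^'n" assume "x \<noteq> 0"
  have "x \<bullet> ((outer v + e *\<^sub>R mat 1) *v x) = (v \<bullet> x)\<^sup>2 + e * (x \<bullet> x)"
    by (simp add: matrix_vector_mult_add_rdistrib scaleR_matrix_vector_assoc[symmetric]
        outer_mult_vec inner_add_right inner_commute power2_eq_square)
  then show "0 < x \<bullet> ((outer v + e *\<^sub>R mat 1) *v x)"
    using assms \<open>x \<noteq> 0\<close> by (simp add: add_nonneg_pos)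
qed

section \<open>Functionals on symmetric matrices and maps of rank one\<close>

text \<open>As \<open>f\<close> is linear on symmetric matrices only, it is composed with the
  symmetrization \<open>s\<close>; the adjoint at \<open>1\<close> then gives the representing
  matrix.\<close>

lemma sym_functional_representation:
  fixes f :: "real^'n^'n \<Rightarrow> real"
  assumes add: "\<And>A B. A \<in> sym_matrices \<Longrightarrow> B \<in> sym_matrices \<Longrightarrow> f (A + B) = f A + f B"
    and scale: "\<And>c A. A \<in> sym_matrices \<Longrightarrow> f (c *\<^sub>R A) = c * f A"
  obtains B where "B \<in> sym_matrices" "\<And>A. A \<in> sym_matrices \<Longrightarrow> f A = A \<bullet> B"
proof -
  define s :: "real^'n^'n \<Rightarrow> real^'n^'n" where "s A = (1/2) *\<^sub>R (A + transpose A)" for A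
  have s_sym: "s A \<in> sym_matrices" for A
    by (rule sym_matricesI) (simp add: s_def transpose_def)
  have "linear (\<lambda>A. f (s A))"
  proof
    fix A B :: "real^'n^'n" and c :: real
    have "s (A + B) = s A + s B" "s (c *\<^sub>R A) = c *\<^sub>R s A"
      by (simp_all add: s_def transpose_def vec_eq_iff algebra_simps)
    then show "f (s (A + B)) = f (s A) + f (s B)" "f (s (c *\<^sub>R A)) = c *\<^sub>R f (s A)"
      by (simp_all add: add scale s_sym)
  qed
  define B where "B = adjoint (\<lambda>A. f (s A)) 1"
  have B: "A \<bullet> B = f (s A)" for A
    using adjoint_works[OF \<open>linear (\<lambda>A. f (s A))\<close>, of A 1] by (simp add: B_def)
  \<comment> \<open>Symmetry of \<open>B\<close> comes from the invariance of \<open>s\<close> under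
    transposition.\<close>
  have "A \<bullet> transpose B = A \<bullet> B" for A
    by (simp add: inner_transpose B s_def add.commute)
  then have "transpose B = B" by (simp flip: vector_eq_ldot[of "transpose B" B])
  moreover have "s A = A" if "A \<in> sym_matrices" for A
    using that by (simp add: s_def sym_matrices_def flip: scaleR_2)
  ultimately show thesis using that[of B] B by (simp add: sym_matrices_def)
qed

lemma rank_one_factor:
  assumes "linear_sym T" "rank_sym T = 1" "A0 \<in> sym_matrices" "T A0 \<noteq> 0" "A \<in> sym_matrices"
  obtains c where "T A = c *\<^sub>R T A0"
proof -
  have "T ` sym_matrices \<subseteq> span {T A0}"
    using assms card_ge_dim_independent[of "{T A0}" "T ` sym_matrices"]
    by (simp add: rank_sym_def)
  then show thesis using assms(5) that by (auto simp: span_singleton)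
qed

theorem theorem3p1:
  fixes T :: "real^'n^'n \<Rightarrow> real^'n^'n"
  assumes "linear_sym T" and "rank_sym T = 1"
  shows "pos_def_preserving T \<longleftrightarrow>
    (\<exists>U\<in>sym_matrices. \<exists>B\<in>sym_matrices.
       pos_def U \<and> B \<noteq> 0 \<and> pos_semidef B \<and>
       (\<forall>A\<in>sym_matrices. T A = trace (A ** B) *\<^sub>R U))"
proof
  assume pres: "pos_def_preserving T"
  define U where "U = T (mat 1)"
  have U: "pos_def U"
    using pres pos_def_mat_1 mat_1_sym by (auto simp: U_def pos_def_preserving_def)
  then have "U \<noteq> 0" by (rule pos_def_nonzero)
  \<comment> \<open>The coordinate along \<open>U\<close>, read off by projection, so that its
    linearity is inherited from \<open>T\<close>.\<close>
  define f where "f A = (T A \<bullet> U) / (U \<bullet> U)" for A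
  have T: "T A = f A *\<^sub>R U" if A: "A \<in> sym_matrices" for A
  proof -
    have "T (mat 1) \<noteq> 0" using \<open>U \<noteq> 0\<close> by (simp add: U_def)
    then obtain c where "T A = c *\<^sub>R U"
      unfolding U_def by (rule rank_one_factor[OF assms mat_1_sym _ A])
    then show ?thesis using \<open>U \<noteq> 0\<close> by (simp add: f_def)
  qed
  have "f (A + B) = f A + f B" if "A \<in> sym_matrices" "B \<in> sym_matrices" for A B
    using assms(1) that by (simp add: linear_sym_def f_def inner_add_left add_divide_distrib)
  moreover have "f (c *\<^sub>R A) = c * f A" if "A \<in> sym_matrices" for A c
    using assms(1) that by (simp add: linear_sym_def f_def)
  ultimately obtain B where B: "B \<in> sym_matrices"
    and fB: "\<And>A. A \<in> sym_matrices \<Longrightarrow> f A = A \<bullet> B"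
    using sym_functional_representation by blast
  \<comment> \<open>This normalization makes \<open>B\<close> nonzero and lets the perturbation by
    \<open>e *\<^sub>R mat 1\<close> contribute exactly \<open>e\<close>.\<close>
  have f1: "mat 1 \<bullet> B = 1"
    using fB[OF mat_1_sym] \<open>U \<noteq> 0\<close> by (simp add: f_def flip: U_def)
  have f_pos: "0 < A \<bullet> B" if "pos_def A" for A
  proof (rule ccontr)
    assume "\<not> 0 < A \<bullet> B"
    have A: "A \<in> sym_matrices" using that by (simp add: pos_def_def)
    have "pos_def ((A \<bullet> B) *\<^sub>R U)"
      using pres that A T[OF A] fB[OF A] by (metis pos_def_preserving_def)
    moreover obtain x :: "real^'n" where "x \<noteq> 0"
      using axis_eq_0_iff zero_neq_one by metis
    ultimately have "0 < (A \<bullet> B) * (x \<bullet> (U *v x))" "0 < x \<bullet> (U *v x)"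
      using U by (auto simp: pos_def_def scaleR_matrix_vector_assoc[symmetric])
    then show False using \<open>\<not> 0 < A \<bullet> B\<close> by (simp add: zero_less_mult_iff)
  qed
  have "0 \<le> v \<bullet> (B *v v)" for v
  \<comment> \<open>Positivity of the functional is known only at positive definite matrices, so
    \<open>outer v\<close> is approached through them.\<close>
  proof (rule field_le_epsilon)
    fix e :: real assume "0 < e"
    have "0 < (outer v + e *\<^sub>R mat 1) \<bullet> B"
      by (rule f_pos[OF pos_def_outer_add[OF \<open>0 < e\<close>]])
    also have "\<dots> = v \<bullet> (B *v v) + e"
      using inner_outer[of B v] f1 by (simp add: inner_add_left inner_commute[of "outer v" B])
    finally show "0 \<le> v \<bullet> (B *v v) + e" by simp
  qed
  then have "pos_semidef B" using B by (simp add: pos_semidef_def)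
  moreover have "B \<noteq> 0" using f1 by auto
  moreover have "T A = trace (A ** B) *\<^sub>R U" if "A \<in> sym_matrices" for A
    using T fB that trace_mult_sym[OF B] by simp
  ultimately show "\<exists>U\<in>sym_matrices. \<exists>B\<in>sym_matrices.
       pos_def U \<and> B \<noteq> 0 \<and> pos_semidef B \<and>
       (\<forall>A\<in>sym_matrices. T A = trace (A ** B) *\<^sub>R U)"
    using U B unfolding pos_def_def by blast
next
  assume "\<exists>U\<in>sym_matrices. \<exists>B\<in>sym_matrices.
       pos_def U \<and> B \<noteq> 0 \<and> pos_semidef B \<and>
       (\<forall>A\<in>sym_matrices. T A = trace (A ** B) *\<^sub>R U)"
  \<comment> \<open>For positive definite \<open>A\<close> the coefficient
    \<open>A \<bullet> B\<close> is positive, and a positive multiple of \<open>U\<close> is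
    positive definite.\<close>
  then show "pos_def_preserving T"
    by (auto simp: pos_def_preserving_def trace_mult_sym intro!: pos_def_scaleR pos_def_inner_pos)
qed

end
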